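(* Let $(y_m)_{m\ge1}$ be a sequence of real numbers equidistributed modulo $1$, and let $\psi:\mathbb{Z}_{\ge1}\to[0,\infty)$ be such that $\sum_{n\ge1}\psi(n)$ diverges. Let $R>0$ and let $F$ be the set of pairs $(x,m)$, with $x$ real and $m$ a positive integer, for which the inequality $\|nx+y_m\|<\psi(n)$ has at least $R$ integer solutions $n\geq1$. For each $m$ let $F_m=\{x\in[0,1):(x,m)\in F\}$. Then the limit $\lim_{M\to\infty}\frac1M\sum_{m=1}^M|F_m|$ exists and equals $1$, where $|\cdot|$ is Lebesgue measure.
   Context: For a real number $t$, $\|t\|$ denotes the distance from $t$ to the nearest integer. *)

theory Defs
  imports "HOL-Analysis.Analysis"
begin

definition dist_nearest_int :: "real \<Rightarrow> real" where
  "dist_nearest_int t = \<bar>t - of_int (round t)\<bar>"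

text \<open>Sequences are indexed by the integers \<open>m \<ge> 1\<close>; the value \<open>y 0\<close> plays no role.\<close>

definition equidistributed_mod1 :: "(nat \<Rightarrow> real) \<Rightarrow> bool" where
  "equidistributed_mod1 y \<longleftrightarrow>
     (\<forall>a b. 0 \<le> a \<and> a < b \<and> b \<le> 1 \<longrightarrow>
        (\<lambda>M. real (card {m \<in> {1..M}. frac (y m) \<in> {a..<b}}) / real M) \<longlonglongrightarrow> b - a)"

text \<open>The real number \<open>R\<close> need not be an integer. The infinite case is separate because
  \<open>card\<close> of an infinite set is \<open>0\<close>.\<close>

definition has_at_least :: "real \<Rightarrow> 'a set \<Rightarrow> bool" where
  "has_at_least R S \<longleftrightarrow> infinite S \<or> R \<le> real (card S)"

definition approx_solutions :: "(nat \<Rightarrow> real) \<Rightarrow> real \<Rightarrow> real \<Rightarrow> nat set" where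
  "approx_solutions \<psi> x y = {n. n \<ge> 1 \<and> dist_nearest_int (real n * x + y) < \<psi> n}"

definition approx_pairs :: "(nat \<Rightarrow> real) \<Rightarrow> (nat \<Rightarrow> real) \<Rightarrow> real \<Rightarrow> (real \<times> nat) set" where
  "approx_pairs y \<psi> R = {(x, m). m \<ge> 1 \<and> has_at_least R (approx_solutions \<psi> x (y m))}"

definition approx_fibre :: "(nat \<Rightarrow> real) \<Rightarrow> (nat \<Rightarrow> real) \<Rightarrow> real \<Rightarrow> nat \<Rightarrow> real set" where
  "approx_fibre y \<psi> R m = {x \<in> {0..<1}. (x, m) \<in> approx_pairs y \<psi> R}"

end

theory Submission imports Defs begin

text \<open>
  Replace the indicator of \<open>\<parallel>t\<parallel> < \<psi> n\<close> by a continuous 1-periodic tent function below it and let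
  \<open>W x y\<close> be the sum over \<open>n \<le> K\<close> of the tents evaluated at \<open>n x + y\<close>; it is a lower bound for
  the number of solutions. For \<open>n \<noteq> m\<close> the maps \<open>(x, y) \<mapsto> n x + y\<close> and \<open>(x, y) \<mapsto> m x + y\<close> are
  independent on the 2-torus, so the variance of \<open>W\<close> there is at most its mean \<open>S\<close>, and \<open>S\<close>
  tends to infinity with \<open>K\<close>. Chebyshev's inequality in \<open>x\<close> alone bounds the measure of the
  complement of each fibre by \<open>v (y m) / (S - R)\<^sup>2\<close> with \<open>v y = \<integral> (W x y - S)\<^sup>2 dx\<close> continuous and
  periodic. By equidistribution the averages of \<open>v (y m)\<close> converge to \<open>\<integral> v \<le> S\<close>, and
  \<open>S / (S - R)\<^sup>2\<close> is arbitrarily small.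
\<close>

section \<open>Periodic functions and their integrals over one period\<close>

lemma periodic_add_nat:
  fixes f :: "real \<Rightarrow> 'a"
  assumes "\<And>t. f (t + 1) = f t"
  shows "f (t + real n) = f t"
proof (induction n)
  case (Suc n)
  have "f (t + real (Suc n)) = f ((t + real n) + 1)"
    by (simp add: algebra_simps)
  then show ?case using Suc assms by simp
qed simp

lemma periodic_add_int:
  fixes f :: "real \<Rightarrow> 'a"
  assumes "\<And>t. f (t + 1) = f t"
  shows "f (t + of_int k) = f t"
proof (cases "k \<ge> 0")
  case True
  then show ?thesis using periodic_add_nat[of f t "nat k", OF assms] by simp
next
  case False
  \<comment> \<open>For negative \<open>k\<close> the natural-number case is read backwards: adding
    \<open>- k\<close> to \<open>t + k\<close> returns to \<open>t\<close>.\<close>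
  then show ?thesis
    using periodic_add_nat[of f "t + of_int k" "nat (- k)", OF assms] by simp
qed

lemma periodic_frac:
  fixes f :: "real \<Rightarrow> 'a"
  assumes "\<And>t. f (t + 1) = f t"
  shows "f (frac t) = f t"
  using periodic_add_int[of f "frac t" "\<lfloor>t\<rfloor>", OF assms] by (simp add: frac_def)

lemma integral_affine_image:
  fixes f :: "real \<Rightarrow> real"
  assumes cont: "continuous_on UNIV f" and "m > 0" "a \<le> b"
  shows "integral {a..b} (\<lambda>x. f (m * x + c)) = integral {m * a + c..m * b + c} f / m"
proof -
  have "(f has_integral integral {m * a + c..m * b + c} f) (cbox (m * a + c) (m * b + c))"
    using continuous_on_subset[OF cont] integrable_continuous_interval
    by (metis box_real(2) integrable_integral subset_UNIV)
  from has_integral_affinity[OF this, of m c] assms(2)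
  have "((\<lambda>x. f (m * x + c)) has_integral integral {m * a + c..m * b + c} f / m)
      ((\<lambda>x. (1 / m) * x + - ((1 / m) * c)) ` cbox (m * a + c) (m * b + c))"
    by (simp add: field_simps)
  \<comment> \<open>The domain comes out as the image under the inverse map, sending
    \<open>x\<close> to \<open>(x - c) / m\<close>; since \<open>m > 0\<close> this image is the
    original interval.\<close>
  moreover have "(\<lambda>x. (1 / m) * x + - ((1 / m) * c)) ` cbox (m * a + c) (m * b + c) = {a..b}"
    using assms(2,3) image_affinity_cbox[of "1 / m" "- ((1 / m) * c)" "m * a + c" "m * b + c"]
    by (auto simp: field_simps)
  ultimately show ?thesis by (simp add: integral_unique)
qed

lemma integral_shift:
  fixes f :: "real \<Rightarrow> real"
  assumes "continuous_on UNIV f" "a \<le> b"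
  shows "integral {a..b} (\<lambda>x. f (x + c)) = integral {a + c..b + c} f"
  using integral_affine_image[of f 1 a b c] assms by simp

text \<open>The period is cut at \<open>n = \<lceil>a\<rceil>\<close>. Moving the piece left of
  \<open>n\<close> by one period to the right produces the interval from \<open>n\<close> to
  \<open>n + 1\<close>, an integer translate of the unit interval.\<close>

lemma integral_periodic_unit:
  fixes f :: "real \<Rightarrow> real"
  assumes cont: "continuous_on UNIV f" and per: "\<And>t. f (t + 1) = f t"
  shows "integral {a..a + 1} f = integral {0..1} f"
proof -
  define n :: real where "n = of_int \<lceil>a\<rceil>"
  have n: "a \<le> n" "n \<le> a + 1" unfolding n_def by linarith+
  have int: "f integrable_on {u..v}" for u v
    using continuous_on_subset[OF cont] integrable_continuous_interval by blast
  have "integral {a..a + 1} f = integral {a..n} f + integral {n..a + 1} f"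
    using n int by (simp add: Henstock_Kurzweil_Integration.integral_combine)
  also have "integral {a..n} f = integral {a + 1..n + 1} f"
    using integral_shift[OF cont n(1), of 1] per by simp
  also have "integral {a + 1..n + 1} f + integral {n..a + 1} f = integral {n..n + 1} f"
    using n int Henstock_Kurzweil_Integration.integral_combine[of n "a + 1" "n + 1" f] by simp
  also have "\<dots> = integral {0..1} (\<lambda>x. f (x + n))"
    using integral_shift[OF cont, of 0 1 n] by (simp add: add.commute)
  also have "\<dots> = integral {0..1} f"
    unfolding n_def by (simp add: periodic_add_int[of f, OF per])
  finally show ?thesis .
qed

lemma integral_periodic_shift:
  fixes f :: "real \<Rightarrow> real"
  assumes cont: "continuous_on UNIV f" and per: "\<And>t. f (t + 1) = f t"
  shows "integral {0..1} (\<lambda>x. f (x + c)) = integral {0..1} f"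
  using integral_shift[OF cont, of 0 1 c] integral_periodic_unit[OF cont per, of c]
  by (simp add: add.commute)

text \<open>Substituting \<open>u = k * x + c\<close> gives \<open>1 / k\<close> times an integral
  over \<open>k\<close> consecutive periods, which all contribute the same amount.\<close>

lemma integral_periodic_dilate:
  fixes f :: "real \<Rightarrow> real"
  assumes cont: "continuous_on UNIV f" and per: "\<And>t. f (t + 1) = f t" and "k > 0"
  shows "integral {0..1} (\<lambda>x. f (real k * x + c)) = integral {0..1} f"
proof -
  have int: "f integrable_on {u..v}" for u v
    using continuous_on_subset[OF cont] integrable_continuous_interval by blast
  have "integral {c..c + real j} f = real j * integral {0..1} f" for j
  proof (induction j)
    case (Suc j)
    have "integral {c..c + real (Suc j)} f
        = integral {c..c + real j} f + integral {c + real j..(c + real j) + 1} f"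
      using int Henstock_Kurzweil_Integration.integral_combine[of c "c + real j" "c + real j + 1" f]
      by (simp add: algebra_simps)
    also have "integral {c + real j..(c + real j) + 1} f = integral {0..1} f"
      by (rule integral_periodic_unit[OF cont per])
    finally show ?case
      using Suc by (simp add: algebra_simps)
  qed simp
  from this[of k] show ?thesis
    using integral_affine_image[OF cont, of "real k" 0 1 c] assms(3) by (simp add: add.commute)
qed

section \<open>Independence on the torus and the second moment\<close>

lemma integral_swap_unit:
  fixes F :: "real \<Rightarrow> real \<Rightarrow> real"
  assumes "continuous_on UNIV (\<lambda>(x, y). F x y)"
  shows "integral {0..1} (\<lambda>x. integral {0..1} (F x)) = integral {0..1} (\<lambda>y. integral {0..1} (\<lambda>x. F x y))"
  using integral_swap_continuous[of 0 0 1 1 F] continuous_on_subset[OF assms subset_UNIV] by simp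

text \<open>With \<open>y\<close> integrated first, a shift by \<open>n * x\<close> removes
  \<open>n\<close> from the first factor and leaves \<open>f y * g ((m - n) * x + y)\<close>. With
  \<open>x\<close> then integrated first, the positive dilation \<open>m - n\<close> averages
  \<open>g\<close> over full periods for every fixed \<open>y\<close>, so the product
  splits.\<close>

lemma double_integral_independent_less:
  fixes f g :: "real \<Rightarrow> real"
  assumes f: "continuous_on UNIV f" "\<And>t. f (t + 1) = f t"
    and g: "continuous_on UNIV g" "\<And>t. g (t + 1) = g t"
    and "n < m"
  shows "integral {0..1} (\<lambda>y. integral {0..1} (\<lambda>x. f (real n * x + y) * g (real m * x + y)))
       = integral {0..1} f * integral {0..1} g"
proof -
  have cf: "continuous_on S (\<lambda>x. f (h x))" if "continuous_on S h" for S :: "'b::topological_space set" and h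
    using continuous_on_compose2[OF f(1) that] by simp
  have cg: "continuous_on S (\<lambda>x. g (h x))" if "continuous_on S h" for S :: "'b::topological_space set" and h
    using continuous_on_compose2[OF g(1) that] by simp
  define k where "k = m - n"
  have k: "k > 0" "real m = real n + real k" using assms(5) by (auto simp: k_def)
  have "integral {0..1} (\<lambda>y. integral {0..1} (\<lambda>x. f (real n * x + y) * g (real m * x + y)))
      = integral {0..1} (\<lambda>x. integral {0..1} (\<lambda>y. f (real n * x + y) * g (real m * x + y)))"
    by (rule integral_swap_unit) (auto simp: split_beta intro!: continuous_intros cf cg)
  also have "\<dots> = integral {0..1} (\<lambda>x. integral {0..1} (\<lambda>y. f y * g (real k * x + y)))"
  proof (rule arg_cong[where f = "integral {0..1}"], rule ext)
    fix x :: real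
    have "integral {0..1} (\<lambda>y. f (y + real n * x) * g (real k * x + (y + real n * x)))
        = integral {0..1} (\<lambda>y. f y * g (real k * x + y))"
    proof (rule integral_periodic_shift)
      show "continuous_on UNIV (\<lambda>y. f y * g (real k * x + y))"
        by (intro continuous_intros cf cg)
      show "f (t + 1) * g (real k * x + (t + 1)) = f t * g (real k * x + t)" for t
        using f(2) g(2)[of "real k * x + t"] by (simp add: add.assoc)
    qed
    then show "integral {0..1} (\<lambda>y. f (real n * x + y) * g (real m * x + y))
        = integral {0..1} (\<lambda>y. f y * g (real k * x + y))"
      by (simp add: k(2) algebra_simps)
  qed
  also have "\<dots> = integral {0..1} (\<lambda>y. integral {0..1} (\<lambda>x. f y * g (real k * x + y)))"
    by (rule integral_swap_unit) (auto simp: split_beta intro!: continuous_intros cf cg)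
  also have "\<dots> = integral {0..1} f * integral {0..1} g"
    using integral_periodic_dilate[OF g k(1)] by simp
  finally show ?thesis .
qed

lemma double_integral_independent:
  fixes f g :: "real \<Rightarrow> real"
  assumes f: "continuous_on UNIV f" "\<And>t. f (t + 1) = f t"
    and g: "continuous_on UNIV g" "\<And>t. g (t + 1) = g t"
    and "n \<noteq> m"
  shows "integral {0..1} (\<lambda>y. integral {0..1} (\<lambda>x. f (real n * x + y) * g (real m * x + y)))
       = integral {0..1} f * integral {0..1} g"
proof (cases "n < m")
  case True
  then show ?thesis using double_integral_independent_less[OF f g] by blast
next
  case False
  then show ?thesis
    using double_integral_independent_less[OF g f, of m n] assms(5) by (simp add: mult.commute)
qed

lemma continuous_on_integral_unit_param:
  fixes F :: "real \<Rightarrow> real \<Rightarrow> real"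
  assumes "continuous_on UNIV (\<lambda>(y, x). F y x)"
  shows "continuous_on UNIV (\<lambda>y. integral {0..1} (F y))"
  using integral_continuous_on_param[of UNIV 0 1 F] continuous_on_subset[OF assms, of "UNIV \<times> {0..1}"]
  by simp

text \<open>Expanding the square, the off-diagonal terms vanish because independence turns them into
  products of zero means. In a diagonal term the \<open>x\<close>-integral is the same for every
  \<open>y\<close>, by dilation with \<open>n > 0\<close>.\<close>

lemma second_moment_eq:
  fixes f :: "nat \<Rightarrow> real \<Rightarrow> real"
  assumes fin: "finite A" and pos: "\<And>n. n \<in> A \<Longrightarrow> n > 0"
    and cont: "\<And>n. continuous_on UNIV (f n)" and per: "\<And>n t. f n (t + 1) = f n t"
    and zero: "\<And>n. n \<in> A \<Longrightarrow> integral {0..1} (f n) = 0"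
  shows "integral {0..1} (\<lambda>y. integral {0..1} (\<lambda>x. (\<Sum>n\<in>A. f n (real n * x + y))\<^sup>2))
       = (\<Sum>n\<in>A. integral {0..1} (\<lambda>t. (f n t)\<^sup>2))"
proof -
  have cf: "continuous_on S (\<lambda>x. f n (h x))"
    if "continuous_on S h" for S :: "'b::topological_space set" and h n
    using continuous_on_compose2[OF cont that] by simp
  have outer: "continuous_on UNIV (\<lambda>y. integral {0..1} (\<lambda>x. f n (real n * x + y) * f m (real m * x + y)))"
    for n m
    by (intro continuous_on_integral_unit_param) (auto simp: split_beta intro!: continuous_intros cf)
  have "integral {0..1} (\<lambda>y. integral {0..1} (\<lambda>x. (\<Sum>n\<in>A. f n (real n * x + y))\<^sup>2))
      = integral {0..1} (\<lambda>y. integral {0..1}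
          (\<lambda>x. \<Sum>n\<in>A. \<Sum>m\<in>A. f n (real n * x + y) * f m (real m * x + y)))"
    by (simp add: power2_eq_square sum_product)
  also have "\<dots> = (\<Sum>n\<in>A. \<Sum>m\<in>A. integral {0..1} (\<lambda>y. integral {0..1}
          (\<lambda>x. f n (real n * x + y) * f m (real m * x + y))))"
    using fin
    by (simp add: integral_sum integrable_sum integrable_continuous_interval
        cf continuous_intros continuous_on_subset[OF outer])
  also have "\<dots> = (\<Sum>n\<in>A. \<Sum>m\<in>A. if n = m then integral {0..1} (\<lambda>t. (f n t)\<^sup>2) else 0)"
  proof (intro sum.cong refl)
    fix n m assume nm: "n \<in> A" "m \<in> A"
    show "integral {0..1} (\<lambda>y. integral {0..1} (\<lambda>x. f n (real n * x + y) * f m (real m * x + y)))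
        = (if n = m then integral {0..1} (\<lambda>t. (f n t)\<^sup>2) else 0)"
    proof (cases "n = m")
      case True
      have "integral {0..1} (\<lambda>x. (f n (real n * x + y))\<^sup>2) = integral {0..1} (\<lambda>t. (f n t)\<^sup>2)" for y
        by (rule integral_periodic_dilate) (auto intro!: continuous_intros cont simp: per pos nm)
      with True show ?thesis by (simp add: power2_eq_square)
    next
      case False
      then show ?thesis
        using double_integral_independent[OF cont per cont per False] nm zero by simp
    qed
  qed
  also have "\<dots> = (\<Sum>n\<in>A. integral {0..1} (\<lambda>t. (f n t)\<^sup>2))"
    using fin by simp
  finally show ?thesis .
qed

section \<open>Averages of periodic functions along an equidistributed sequence\<close>

lemma equidistributed_average_step:
  assumes "equidistributed_mod1 y" and "N > 0"
  shows "(\<lambda>M. (\<Sum>m = 1..M. s (nat \<lfloor>real N * frac (y m)\<rfloor>)) / real M)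
    \<longlonglongrightarrow> (\<Sum>j<N. s j) / real N"
proof -
  have cell: "nat \<lfloor>real N * frac t\<rfloor> = j \<longleftrightarrow> frac t \<in> {real j / real N..<real (Suc j) / real N}"
    for t :: real and j
  proof -
    have "nat \<lfloor>real N * frac t\<rfloor> = j \<longleftrightarrow> \<lfloor>real N * frac t\<rfloor> = int j"
      by (metis frac_ge_0 int_nat_eq mult_nonneg_nonneg nat_int of_nat_0_le_iff zero_le_floor)
    also have "\<dots> \<longleftrightarrow> real j \<le> real N * frac t \<and> real N * frac t < real j + 1"
      by (simp add: floor_eq_iff)
    finally show ?thesis using assms(2) by (simp add: field_simps)
  qed
  have bound: "nat \<lfloor>real N * frac t\<rfloor> < N" for t :: real
  proof -
    have "real N * frac t < real N * 1"
      using assms(2) frac_lt_1 by (intro mult_strict_left_mono) auto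
    then show ?thesis using assms(2) by (simp add: nat_less_iff floor_less_iff)
  qed
  \<comment> \<open>Equidistribution applies to each of the \<open>N\<close> half-open cells;
    finitely many limits may be added with weights \<open>s j\<close>.\<close>
  have "(\<lambda>M. \<Sum>j<N. s j * (real (card {m \<in> {1..M}.
          frac (y m) \<in> {real j / real N..<real (Suc j) / real N}}) / real M))
      \<longlonglongrightarrow> (\<Sum>j<N. s j * (real (Suc j) / real N - real j / real N))"
  proof (intro tendsto_sum tendsto_mult tendsto_const)
    fix j assume "j \<in> {..<N}"
    then have "0 \<le> real j / real N \<and> real j / real N < real (Suc j) / real N \<and> real (Suc j) / real N \<le> 1"
      by (auto simp: field_simps)
    with assms(1) show "(\<lambda>M. real (card {m \<in> {1..M}. frac (y m) \<in>
        {real j / real N..<real (Suc j) / real N}}) / real M)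
        \<longlonglongrightarrow> real (Suc j) / real N - real j / real N"
      unfolding equidistributed_mod1_def by blast
  qed
  moreover have "(\<Sum>m = 1..M. s (nat \<lfloor>real N * frac (y m)\<rfloor>))
      = (\<Sum>j<N. s j * real (card {m \<in> {1..M}. frac (y m) \<in> {real j / real N..<real (Suc j) / real N}}))"
    for M
  proof -
    \<comment> \<open>The indices \<open>m\<close> are grouped by the cell containing
      \<open>frac (y m)\<close>; \<open>bound\<close> ensures that the cells with
      \<open>j < N\<close> catch them all.\<close>
    have "(\<Sum>m = 1..M. s (nat \<lfloor>real N * frac (y m)\<rfloor>))
      = (\<Sum>j<N. \<Sum>m\<in>{m \<in> {1..M}. nat \<lfloor>real N * frac (y m)\<rfloor> = j}. s (nat \<lfloor>real N * frac (y m)\<rfloor>))"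
      by (rule sum.group[symmetric]) (use bound in auto)
    also have "\<dots> = (\<Sum>j<N. s j * real (card {m \<in> {1..M}. nat \<lfloor>real N * frac (y m)\<rfloor> = j}))"
      by (intro sum.cong) (auto simp: mult.commute)
    finally show ?thesis unfolding cell .
  qed
  moreover have "(\<Sum>j<N. s j * (real (Suc j) / real N - real j / real N)) = (\<Sum>j<N. s j) / real N"
    by (simp add: diff_divide_distrib[symmetric] sum_divide_distrib)
  ultimately show ?thesis by (simp add: sum_divide_distrib)
qed

lemma integral_unit_partition:
  fixes h :: "real \<Rightarrow> real"
  assumes "continuous_on UNIV h" and "N > 0"
  shows "integral {0..1} h = (\<Sum>j<N. integral {real j / real N..real (Suc j) / real N} h)"
proof -
  have int: "h integrable_on {u..v}" for u v
    using continuous_on_subset[OF assms(1)] integrable_continuous_interval by blast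
  have "integral {0..real k / real N} h = (\<Sum>j<k. integral {real j / real N..real (Suc j) / real N} h)" for k
  proof (induction k)
    case (Suc k)
    have "integral {0..real (Suc k) / real N} h
        = integral {0..real k / real N} h + integral {real k / real N..real (Suc k) / real N} h"
      using int assms(2)
      by (intro Henstock_Kurzweil_Integration.integral_combine[symmetric]) (auto simp: field_simps)
    with Suc show ?case by simp
  qed simp
  from this[of N] show ?thesis using assms(2) by simp
qed

text \<open>Uniform continuity replaces \<open>h\<close> by a step function taking its values at the
  left endpoints of \<open>N\<close> equal cells. The errors in the integral, in the average, and in
  the convergence of the step averages are each at most \<open>e / 4\<close>, which leaves room
  below \<open>e\<close>.\<close>

lemma equidistributed_average_periodic:
  fixes h :: "real \<Rightarrow> real"
  assumes equi: "equidistributed_mod1 y"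
    and cont: "continuous_on UNIV h" and per: "\<And>t. h (t + 1) = h t"
  shows "(\<lambda>M. (\<Sum>m = 1..M. h (y m)) / real M) \<longlonglongrightarrow> integral {0..1} h"
proof (rule LIMSEQ_I)
  fix e :: real assume "e > 0"
  then have e: "e / 4 > 0" by simp
  have "uniformly_continuous_on {0..1} h"
    using cont continuous_on_subset by (intro compact_uniformly_continuous) auto
  from uniformly_continuous_onE[OF this e] obtain d where d: "d > 0"
    "\<And>s t. s \<in> {0..1} \<Longrightarrow> t \<in> {0..1} \<Longrightarrow> dist t s < d \<Longrightarrow> dist (h t) (h s) < e / 4"
    by metis
  obtain N :: nat where N: "N > 0" "1 / real N < d"
    using d(1) reals_Archimedean[of d] by (metis inverse_eq_divide zero_less_Suc)
  have near: "\<bar>h t - h (real j / real N)\<bar> \<le> e / 4"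
    if "j < N" "real j / real N \<le> t" "t < real (Suc j) / real N" for j t
  proof -
    have "real (Suc j) / real N \<le> 1" using that N by (simp add: field_simps)
    moreover have step: "real (Suc j) / real N = real j / real N + 1 / real N"
      by (simp add: add_divide_distrib)
    moreover have "0 \<le> real j / real N" by simp
    ultimately have "real j / real N \<in> {0..1}" "t \<in> {0..1}"
      unfolding atLeastAtMost_iff using that by linarith+
    moreover have "dist t (real j / real N) < d"
      unfolding dist_real_def using that N step by linarith
    ultimately have "dist (h t) (h (real j / real N)) < e / 4"
      by (rule d(2))
    then show ?thesis by (simp add: dist_real_def)
  qed
  define S where "S = (\<Sum>j<N. h (real j / real N)) / real N"
  have cell_int: "\<bar>integral {real j / real N..real (Suc j) / real N} h - h (real j / real N) / real N\<bar>
      \<le> e / 4 / real N" if "j < N" for j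
  proof -
    let ?I = "{real j / real N..real (Suc j) / real N}"
    have le: "real j / real N \<le> real (Suc j) / real N" by (simp add: divide_right_mono)
    have int: "h integrable_on ?I"
      using continuous_on_subset[OF cont] integrable_continuous_interval by blast
    have len: "real (Suc j) / real N - real j / real N = 1 / real N"
      by (simp add: diff_divide_distrib[symmetric])
    have "closure {real j / real N..<real (Suc j) / real N} = ?I"
      using N by (intro closure_atLeastLessThan) (simp add: field_simps)
    \<comment> \<open>The estimate \<open>near\<close> covers only the half-open cell; continuity
      extends it to the right endpoint, as the integral over the closed cell requires.\<close>
    moreover have "\<bar>h t - h (real j / real N)\<bar> \<le> e / 4"
      if "t \<in> closure {real j / real N..<real (Suc j) / real N}" for t
      using that
      by (rule continuous_le_on_closure[rotated])
        (use near \<open>j < N\<close> in \<open>auto intro!: continuous_intros continuous_on_subset[OF cont]\<close>)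
    ultimately have "norm (integral ?I (\<lambda>t. h t - h (real j / real N)))
        \<le> (e / 4) * (real (Suc j) / real N - real j / real N)"
      using e by (intro integral_bound[OF le]) (auto intro!: continuous_intros continuous_on_subset[OF cont])
    moreover have "integral ?I (\<lambda>t. h t - h (real j / real N))
        = integral ?I h - h (real j / real N) / real N"
      using int le by (subst Henstock_Kurzweil_Integration.integral_diff) (auto simp: diff_divide_distrib[symmetric])
    ultimately show ?thesis unfolding len by simp
  qed
  have "\<bar>integral {0..1} h - S\<bar>
      = \<bar>\<Sum>j<N. integral {real j / real N..real (Suc j) / real N} h - h (real j / real N) / real N\<bar>"
    unfolding S_def integral_unit_partition[OF cont N(1)] by (simp add: sum_subtractf sum_divide_distrib)
  also have "\<dots> \<le> (\<Sum>j<N. e / 4 / real N)"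
    by (rule order_trans[OF sum_abs sum_mono]) (use cell_int in auto)
  also have "\<dots> = e / 4" using N by simp
  finally have step_int: "\<bar>integral {0..1} h - S\<bar> \<le> e / 4" .
  define A where "A M = (\<Sum>m = 1..M. h (real (nat \<lfloor>real N * frac (y m)\<rfloor>) / real N)) / real M" for M
  have step_avg: "\<bar>(\<Sum>m = 1..M. h (y m)) / real M - A M\<bar> \<le> e / 4" for M
  proof -
    have "\<bar>h (y m) - h (real (nat \<lfloor>real N * frac (y m)\<rfloor>) / real N)\<bar> \<le> e / 4" for m
    proof -
      let ?j = "nat \<lfloor>real N * frac (y m)\<rfloor>"
      have "0 \<le> \<lfloor>real N * frac (y m)\<rfloor>" by simp
      then have "real ?j = of_int \<lfloor>real N * frac (y m)\<rfloor>" by simp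
      then have j: "real ?j \<le> real N * frac (y m)" "real N * frac (y m) < real ?j + 1" by linarith+
      moreover have "real N * frac (y m) < real N * 1"
        using N frac_lt_1 by (intro mult_strict_left_mono) auto
      ultimately have "?j < N" by linarith
      then have "\<bar>h (frac (y m)) - h (real ?j / real N)\<bar> \<le> e / 4"
        using j N by (intro near) (auto simp: field_simps)
      then show ?thesis by (simp add: periodic_frac[of h, OF per])
    qed
    then have "\<bar>\<Sum>m = 1..M. h (y m) - h (real (nat \<lfloor>real N * frac (y m)\<rfloor>) / real N)\<bar>
        \<le> (\<Sum>m = 1..M. e / 4)"
      by (intro order_trans[OF sum_abs sum_mono]) auto
    then have "\<bar>(\<Sum>m = 1..M. h (y m)) - (\<Sum>m = 1..M. h (real (nat \<lfloor>real N * frac (y m)\<rfloor>) / real N))\<bar>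
        \<le> real M * (e / 4)"
      by (simp add: sum_subtractf)
    \<comment> \<open>For \<open>M = 0\<close> both averages are \<open>0\<close>, since division by
      zero yields \<open>0\<close>.\<close>
    then show ?thesis
      unfolding A_def diff_divide_distrib[symmetric] using e
      by (cases "M = 0") (simp_all add: field_simps abs_divide)
  qed
  have "A \<longlonglongrightarrow> S"
    unfolding A_def S_def by (rule equidistributed_average_step[OF equi N(1)])
  from LIMSEQ_D[OF this e] obtain M0 where M0: "\<And>M. M \<ge> M0 \<Longrightarrow> norm (A M - S) < e / 4" by blast
  show "\<exists>M0. \<forall>M\<ge>M0. norm ((\<Sum>m = 1..M. h (y m)) / real M - integral {0..1} h) < e"
  proof (intro exI allI impI)
    fix M assume "M \<ge> M0"
    from M0[OF this] step_avg[of M] step_int \<open>e > 0\<close>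
    show "norm ((\<Sum>m = 1..M. h (y m)) / real M - integral {0..1} h) < e"
      unfolding real_norm_def by argo
  qed
qed


section \<open>Distance to the nearest integer, tent functions and their mean and variance\<close>

lemma dist_nearest_int_le: "dist_nearest_int t \<le> \<bar>t - of_int k\<bar>"
  unfolding dist_nearest_int_def by (rule round_diff_minimal)

lemma dist_nearest_int_nonneg: "0 \<le> dist_nearest_int t"
  by (simp add: dist_nearest_int_def)

lemma dist_nearest_int_lipschitz: "\<bar>dist_nearest_int s - dist_nearest_int t\<bar> \<le> \<bar>s - t\<bar>"
proof -
  have "dist_nearest_int s \<le> dist_nearest_int t + \<bar>s - t\<bar>" for s t
    \<comment> \<open>The integer nearest to \<open>t\<close> competes as an approximation to
      \<open>s\<close>.\<close>
    using dist_nearest_int_le[of s "round t"] unfolding dist_nearest_int_def[of t] by linarith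
  from this[of s t] this[of t s] show ?thesis by linarith
qed

lemma continuous_on_dist_nearest_int: "continuous_on UNIV dist_nearest_int"
  by (rule lipschitz_on_continuous_on[of 1])
    (auto intro!: lipschitz_onI simp: dist_real_def dist_nearest_int_lipschitz)

lemma dist_nearest_int_add_1: "dist_nearest_int (t + 1) = dist_nearest_int t"
proof (rule antisym)
  show "dist_nearest_int (t + 1) \<le> dist_nearest_int t"
    using dist_nearest_int_le[of "t + 1" "round t + 1"] unfolding dist_nearest_int_def[of t] by simp
  show "dist_nearest_int t \<le> dist_nearest_int (t + 1)"
    using dist_nearest_int_le[of t "round (t + 1) - 1"] unfolding dist_nearest_int_def[of "t + 1"]
    by (simp add: algebra_simps)
qed

text \<open>At \<open>c = 0\<close> division by zero makes this the zero function, which is the intended value.\<close>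

definition tent :: "real \<Rightarrow> real \<Rightarrow> real" where
  "tent c t = max 0 (c - dist_nearest_int t) / c"

lemma continuous_on_tent: "continuous_on UNIV (tent c)"
  unfolding tent_def
  by (cases "c = 0") (auto intro!: continuous_intros continuous_on_dist_nearest_int)

lemma tent_periodic: "tent c (t + 1) = tent c t"
  by (simp add: tent_def dist_nearest_int_add_1)

lemma tent_nonneg: "0 \<le> c \<Longrightarrow> 0 \<le> tent c t"
  by (simp add: tent_def)

lemma tent_le_1: "0 \<le> c \<Longrightarrow> tent c t \<le> 1"
  using dist_nearest_int_nonneg[of t] by (cases "c = 0") (auto simp: tent_def field_simps)

lemma tent_eq_0: "0 \<le> c \<Longrightarrow> c \<le> dist_nearest_int t \<Longrightarrow> tent c t = 0"
  by (simp add: tent_def)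

text \<open>One side of the peak suffices: the tent is at least \<open>1 / 2\<close> on
  \<open>{0..c / 2}\<close>, and \<open>c \<le> 1\<close> keeps this interval inside the unit
  interval. The linear lower bound in \<open>c\<close> carries divergence over to the means.\<close>

lemma integral_tent_ge:
  assumes "0 \<le> c" "c \<le> 1"
  shows "c / 4 \<le> integral {0..1} (tent c)"
proof (cases "c = 0")
  case True
  then have "tent c = (\<lambda>_. 0)" by (simp add: tent_def fun_eq_iff)
  with True show ?thesis by simp
next
  case False
  with assms have c: "c > 0" by simp
  have int: "tent c integrable_on {u..v}" for u v
    using continuous_on_subset[OF continuous_on_tent] integrable_continuous_interval by blast
  have half: "1 / 2 \<le> tent c t" if "t \<in> {0..c / 2}" for t
    using that c dist_nearest_int_le[of t 0] by (auto simp: tent_def field_simps)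
  have "c / 4 = integral {0..c / 2} (\<lambda>_. 1 / 2)" using c by simp
  also have "\<dots> \<le> integral {0..c / 2} (tent c)"
    using half by (intro integral_le int) auto
  also have "\<dots> \<le> integral {0..1} (tent c)"
    using assms by (intro integral_subset_le int) (auto simp: tent_nonneg)
  finally show ?thesis .
qed

text \<open>Values in the unit interval satisfy \<open>f t * f t \<le> f t\<close>, so the variance
  is at most \<open>a - a * a\<close>, where \<open>a\<close> is the mean.\<close>

lemma integral_centred_square_le:
  fixes f :: "real \<Rightarrow> real"
  assumes cont: "continuous_on UNIV f" and "\<And>t. 0 \<le> f t" "\<And>t. f t \<le> 1"
  shows "integral {0..1} (\<lambda>t. (f t - integral {0..1} f)\<^sup>2) \<le> integral {0..1} f"
proof -
  define a where "a = integral {0..1} f"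
  have cont': "continuous_on {0..1} f" using cont continuous_on_subset by blast
  have "integral {0..1} (\<lambda>t. (f t - a)\<^sup>2) \<le> integral {0..1} (\<lambda>t. f t * (1 - 2 * a) + a\<^sup>2)"
  proof (intro integral_le integrable_continuous_interval continuous_intros cont')
    fix t
    have "f t * f t \<le> f t * 1" using assms(2,3) by (intro mult_left_mono) auto
    then show "(f t - a)\<^sup>2 \<le> f t * (1 - 2 * a) + a\<^sup>2"
      by (simp add: power2_eq_square algebra_simps)
  qed
  also have "\<dots> = a * (1 - 2 * a) + a\<^sup>2"
    unfolding a_def
    by (subst integral_add) (auto intro!: integrable_continuous_interval continuous_intros cont')
  also have "\<dots> \<le> a" by (simp add: power2_eq_square algebra_simps)
  finally show ?thesis unfolding a_def .
qed

section \<open>Measurability of the fibres and Chebyshev's inequality\<close>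

lemma has_at_least_iff_initial:
  fixes S :: "nat set"
  shows "has_at_least R S \<longleftrightarrow> (\<exists>K. R \<le> real (card (S \<inter> {..K})))"
proof
  assume "has_at_least R S"
  show "\<exists>K. R \<le> real (card (S \<inter> {..K}))"
  proof (cases "finite S")
    case True
    then obtain K where "S \<subseteq> {..K}" using finite_nat_iff_bounded_le by blast
    then have "S \<inter> {..K} = S" by blast
    with True \<open>has_at_least R S\<close> show ?thesis
      unfolding has_at_least_def by (metis (no_types))
  next
    case False
    \<comment> \<open>The ceiling turns the real threshold into a cardinality; \<open>nat\<close>
      sends a negative one to \<open>0\<close>.\<close>
    then obtain T where T: "T \<subseteq> S" "finite T" "card T = nat \<lceil>R\<rceil>"
      using infinite_arbitrarily_large by blast
    then obtain K where "T \<subseteq> {..K}" using finite_nat_iff_bounded_le by blast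
    with T have "card T \<le> card (S \<inter> {..K})" by (intro card_mono) auto
    moreover have "R \<le> real (nat \<lceil>R\<rceil>)" by (rule real_nat_ceiling_ge)
    ultimately show ?thesis using T(3) by (intro exI[of _ K]) linarith
  qed
next
  assume "\<exists>K. R \<le> real (card (S \<inter> {..K}))"
  then obtain K where K: "R \<le> real (card (S \<inter> {..K}))" by blast
  show "has_at_least R S"
  proof (cases "finite S")
    case True
    then have "card (S \<inter> {..K}) \<le> card S" by (intro card_mono) auto
    with K show ?thesis unfolding has_at_least_def by linarith
  qed (simp add: has_at_least_def)
qed

text \<open>The number of solutions up to \<open>K\<close> is a finite sum of indicators of open
  sets in \<open>x\<close>. By \<open>has_at_least_iff_initial\<close>, having at least
  \<open>R\<close> solutions is a countable union over \<open>K\<close> of Borel conditions.\<close>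

lemma approx_fibre_borel: "approx_fibre y \<psi> R m \<in> sets borel"
proof (cases "m \<ge> 1")
  case True
  define B where "B n = {x. dist_nearest_int (real n * x + y m) < \<psi> n}" for n
  have B: "B n \<in> sets borel" for n
    unfolding B_def
    by (intro borel_open open_Collect_less continuous_intros
        continuous_on_compose2[OF continuous_on_dist_nearest_int]) auto
  have "real (card (approx_solutions \<psi> x (y m) \<inter> {..K})) = (\<Sum>n = 1..K. indicator (B n) x)" for x K
  proof -
    have "approx_solutions \<psi> x (y m) \<inter> {..K} = {n \<in> {1..K}. x \<in> B n}"
      by (auto simp: approx_solutions_def B_def)
    then show ?thesis by (simp add: indicator_def sum.If_cases Int_def)
  qed
  then have "approx_fibre y \<psi> R m = {0..<1} \<inter> (\<Union>K. {x \<in> space borel. R \<le> (\<Sum>n = 1..K. indicator (B n) x)})"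
    using True by (auto simp: approx_fibre_def approx_pairs_def has_at_least_iff_initial)
  also have "\<dots> \<in> sets borel"
    using B by (intro sets.Int sets.countable_UN) (auto intro!: borel_measurable_le)
  finally show ?thesis .
qed (simp add: approx_fibre_def approx_pairs_def)

text \<open>This is Chebyshev's inequality: on the part of the unit interval outside
  \<open>F\<close>, \<open>W\<close> stays at least \<open>S - R\<close> below \<open>S\<close>, so
  \<open>(S - R)\<^sup>2\<close> times the indicator of that part lies below
  \<open>(W x - S)\<^sup>2\<close>.\<close>

lemma measure_unit_diff_le_second_moment:
  fixes W :: "real \<Rightarrow> real"
  assumes F: "F \<in> sets borel" "F \<subseteq> {0..<1}"
    and cont: "continuous_on UNIV W"
    and low: "\<And>x. x \<in> {0..<1} \<Longrightarrow> x \<notin> F \<Longrightarrow> W x \<le> R" and "R < S"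
  shows "1 - measure lebesgue F \<le> integral {0..1} (\<lambda>x. (W x - S)\<^sup>2) / (S - R)\<^sup>2"
proof -
  let ?C = "{0..<1} - F"
  have C: "?C \<in> lmeasurable"
    using F by (intro bounded_set_imp_lmeasurable) (auto intro: bounded_subset[of "{0..1}"])
  have Fm: "F \<in> lmeasurable"
    using F bounded_subset[of "{0..<1}" F] by (intro bounded_set_imp_lmeasurable) auto
  have "measure lebesgue ?C = measure lebesgue {0..<1::real} - measure lebesgue F"
    using F Fm by (intro measure_Diff) (auto simp: fmeasurableD2)
  then have "1 - measure lebesgue F = measure lebesgue ?C" by simp
  moreover have "(S - R)\<^sup>2 * measure lebesgue ?C \<le> integral {0..1} (\<lambda>x. (W x - S)\<^sup>2)"
  proof -
    have "((\<lambda>x. indicator ?C x :: real) has_integral measure lebesgue ?C) UNIV"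
      using C by (simp add: lmeasurable_iff_has_integral)
    moreover have "(\<lambda>x. indicator ?C x :: real) = (\<lambda>x. if x \<in> {0..1} then indicator ?C x else 0)"
      by (auto simp: fun_eq_iff indicator_def)
    ultimately have "((\<lambda>x. indicator ?C x :: real) has_integral measure lebesgue ?C) {0..1}"
      using has_integral_restrict_UNIV[of "{0..1}" "\<lambda>x. indicator ?C x :: real"] by metis
    then have "((\<lambda>x. (S - R)\<^sup>2 * indicator ?C x) has_integral (S - R)\<^sup>2 * measure lebesgue ?C) {0..1}"
      by (rule has_integral_mult_right)
    moreover have "((\<lambda>x. (W x - S)\<^sup>2) has_integral integral {0..1} (\<lambda>x. (W x - S)\<^sup>2)) {0..1}"
      by (intro integrable_integral integrable_continuous_interval continuous_intros
          continuous_on_subset[OF cont]) auto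
    ultimately show ?thesis
    proof (rule has_integral_le)
      fix x :: real
      show "(S - R)\<^sup>2 * indicator ?C x \<le> (W x - S)\<^sup>2"
      proof (cases "x \<in> ?C")
        case True
        with low have "W x \<le> R" by blast
        then have "(S - R)\<^sup>2 \<le> (S - W x)\<^sup>2" using assms(5) by (intro power_mono) auto
        with True show ?thesis by (simp add: power2_commute)
      qed simp
    qed
  qed
  ultimately show ?thesis using assms(5) by (simp add: pos_le_divide_eq mult.commute)
qed

section \<open>Divergent series and the counting bound by tents\<close>

lemma partial_sums_unbounded:
  fixes a :: "nat \<Rightarrow> real"
  assumes "\<not> summable (\<lambda>n. a (Suc n))" and "\<And>n. n \<ge> 1 \<Longrightarrow> 0 \<le> a n"
  obtains K where "B < (\<Sum>n = 1..K. a n)"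
proof -
  have "\<exists>K. B < (\<Sum>n<K. a (Suc n))"
  proof (rule ccontr)
    assume "\<not> ?thesis"
    then have "summable (\<lambda>n. a (Suc n))"
      using assms(2) by (intro summableI_nonneg_bounded[of _ B]) (auto simp: not_less)
    with assms(1) show False by contradiction
  qed
  then show ?thesis using that by (auto simp: sum.atLeast1_atMost_eq)
qed

text \<open>If the truncated series converged, its terms would eventually lie below
  \<open>\<delta>\<close>, where truncation changes nothing.\<close>

lemma not_summable_min:
  fixes a :: "nat \<Rightarrow> real"
  assumes "\<not> summable a" "\<delta> > 0"
  shows "\<not> summable (\<lambda>n. min (a n) \<delta>)"
proof
  assume sum: "summable (\<lambda>n. min (a n) \<delta>)"
  from order_tendstoD(2)[OF summable_LIMSEQ_zero[OF this] assms(2)]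
  have "eventually (\<lambda>n. min (a n) \<delta> = a n) sequentially"
    by eventually_elim auto
  from summable_cong[OF this] sum assms(1) show False by simp
qed

text \<open>A tent is at most \<open>1\<close> and vanishes unless \<open>n\<close> is a solution,
  because \<open>c n \<le> \<psi> n\<close>. The tent sum is therefore at most the number of
  solutions, which is finite and below \<open>R\<close> here.\<close>

lemma tent_sum_le_if_not_has_at_least:
  assumes "\<not> has_at_least R (approx_solutions \<psi> x y)"
    and "\<And>n. n \<ge> 1 \<Longrightarrow> 0 \<le> c n" "\<And>n. n \<ge> 1 \<Longrightarrow> c n \<le> \<psi> n"
  shows "(\<Sum>n = 1..K. tent (c n) (real n * x + y)) \<le> R"
proof -
  let ?S = "approx_solutions \<psi> x y"
  have "(\<Sum>n = 1..K. tent (c n) (real n * x + y)) \<le> (\<Sum>n = 1..K. if n \<in> ?S then 1 else 0)"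
  proof (rule sum_mono)
    fix n assume "n \<in> {1..K}"
    then show "tent (c n) (real n * x + y) \<le> (if n \<in> ?S then 1 else 0)"
      using assms(2,3)[of n] tent_le_1[of "c n"] tent_eq_0[of "c n"]
      by (auto simp: approx_solutions_def)
  qed
  also have "\<dots> = real (card ({1..K} \<inter> ?S))"
    by (simp add: sum.If_cases)
  also have "\<dots> \<le> real (card ?S)"
    using assms(1) by (auto simp: has_at_least_def intro!: card_mono)
  also have "\<dots> \<le> R"
    using assms(1) by (auto simp: has_at_least_def)
  finally show ?thesis .
qed

section \<open>Convergence of the averaged fibre measures\<close>

theorem theorem4p1:
  fixes y :: "nat \<Rightarrow> real" and \<psi> :: "nat \<Rightarrow> real" and R :: real
  assumes "equidistributed_mod1 y"
    and "\<And>n. n \<ge> 1 \<Longrightarrow> 0 \<le> \<psi> n"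
    and "\<not> summable (\<lambda>n. \<psi> (Suc n))"
    and "R > 0"
  shows "(\<lambda>M. (1 / real M) * (\<Sum>m = 1..M. measure lebesgue (approx_fibre y \<psi> R m))) \<longlonglongrightarrow> 1"
proof (rule LIMSEQ_I)
  fix e :: real assume e: "e > 0"
  \<comment> \<open>Truncation at \<open>1\<close> makes \<open>integral_tent_ge\<close> applicable
    and preserves divergence.\<close>
  define c where "c n = min (\<psi> n) 1" for n
  have c: "0 \<le> c n" "c n \<le> 1" "c n \<le> \<psi> n" if "n \<ge> 1" for n
    using assms(2)[OF that] by (auto simp: c_def)
  define a where "a n = integral {0..1} (tent (c n))" for n
  have a: "c n / 4 \<le> a n" "0 \<le> a n" if "n \<ge> 1" for n
    using integral_tent_ge[of "c n"] c[OF that] by (auto simp: a_def)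
  have "\<not> summable (\<lambda>n. c (Suc n))"
    unfolding c_def using assms(3) by (intro not_summable_min) auto
  moreover have "summable (\<lambda>n. c (Suc n))" if "summable (\<lambda>n. a (Suc n))"
  proof (rule summable_comparison_test'[OF summable_mult[OF that, of 4]])
    show "norm (c (Suc n)) \<le> 4 * a (Suc n)" for n
      using a(1)[of "Suc n"] c(1)[of "Suc n"] by simp
  qed
  ultimately have "\<not> summable (\<lambda>n. a (Suc n))" by blast
  \<comment> \<open>The bound \<open>S > 2 * R\<close> gives \<open>S - R > S / 2\<close>, hence
    \<open>S / (S - R)\<^sup>2 < 4 / S\<close>; the bound \<open>S > 4 / e\<close> makes this less
    than \<open>e\<close>.\<close>
  then obtain K where K: "max (2 * R) (4 / e) < (\<Sum>n = 1..K. a n)"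
    using partial_sums_unbounded a(2) by blast
  define S where "S = (\<Sum>n = 1..K. a n)"
  have S: "2 * R < S" "4 / e < S" using K by (auto simp: S_def)
  define W where "W x t = (\<Sum>n = 1..K. tent (c n) (real n * x + t))" for x t
  define v where "v t = integral {0..1} (\<lambda>x. (W x t - S)\<^sup>2)" for t
  have cont_tent: "continuous_on T (\<lambda>z. tent d (h z))"
    if "continuous_on T h" for T :: "'b::topological_space set" and d h
    using continuous_on_compose2[OF continuous_on_tent that] by simp
  have v_cont: "continuous_on UNIV v"
    unfolding v_def W_def
    by (intro continuous_on_integral_unit_param) (auto simp: split_beta intro!: continuous_intros cont_tent)
  have v_per: "v (t + 1) = v t" for t
    unfolding v_def W_def using tent_periodic by (simp add: add.assoc[symmetric])
  \<comment> \<open>Distributing \<open>S\<close> as the sum of the means \<open>a n\<close> writes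
    \<open>W x t - S\<close> as a sum of mean-zero functions, as \<open>second_moment_eq\<close>
    requires.\<close>
  have "integral {0..1} v = integral {0..1} (\<lambda>t. integral {0..1}
      (\<lambda>x. (\<Sum>n = 1..K. (\<lambda>s. tent (c n) s - a n) (real n * x + t))\<^sup>2))"
    unfolding v_def W_def S_def by (simp add: sum_subtractf)
  also have "\<dots> = (\<Sum>n = 1..K. integral {0..1} (\<lambda>s. (tent (c n) s - a n)\<^sup>2))"
    by (rule second_moment_eq)
      (auto simp: tent_periodic a_def integrable_continuous_interval cont_tent
        Henstock_Kurzweil_Integration.integral_diff intro!: continuous_intros cont_tent)
  also have "\<dots> \<le> S"
    unfolding S_def a_def
    by (intro sum_mono integral_centred_square_le continuous_on_tent) (auto simp: tent_nonneg tent_le_1 c)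
  finally have v_int: "integral {0..1} v \<le> S" .
  have "S * 4 < e * (S * S)"
    using S e assms(4) mult_strict_right_mono[of 4 "e * S" S] by (simp add: field_simps)
  moreover have "(S / 2)\<^sup>2 \<le> (S - R)\<^sup>2"
    using S assms(4) by (intro power_mono) auto
  then have "e * (S * S) \<le> e * (4 * (S - R)\<^sup>2)"
    using e by (intro mult_left_mono) (auto simp: power2_eq_square field_simps)
  ultimately have "S < e * (S - R)\<^sup>2" by linarith
  with v_int have "integral {0..1} v < e * (S - R)\<^sup>2" by linarith
  \<comment> \<open>Equidistribution transfers the strict bound from the integral of
    \<open>v\<close> to the averages of \<open>v (y m)\<close> for all large
    \<open>M\<close>.\<close>
  with equidistributed_average_periodic[OF assms(1) v_cont v_per]
  have "eventually (\<lambda>M. (\<Sum>m = 1..M. v (y m)) / real M < e * (S - R)\<^sup>2) sequentially"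
    by (rule order_tendstoD(2))
  then obtain M0 where M0: "\<And>M. M \<ge> M0 \<Longrightarrow> (\<Sum>m = 1..M. v (y m)) / real M < e * (S - R)\<^sup>2"
    unfolding eventually_sequentially by blast
  have SR: "R < S" using S assms(4) by linarith
  have fibre_low: "1 - v (y m) / (S - R)\<^sup>2 \<le> measure lebesgue (approx_fibre y \<psi> R m)" if "m \<ge> 1" for m
  proof -
    have "1 - measure lebesgue (approx_fibre y \<psi> R m) \<le> v (y m) / (S - R)\<^sup>2"
      unfolding v_def
    proof (rule measure_unit_diff_le_second_moment[OF approx_fibre_borel _ _ _ SR])
      show "approx_fibre y \<psi> R m \<subseteq> {0..<1}" by (auto simp: approx_fibre_def)
      show "continuous_on UNIV (\<lambda>x. W x (y m))"
        unfolding W_def by (intro continuous_intros cont_tent)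
      fix x :: real assume "x \<in> {0..<1}" "x \<notin> approx_fibre y \<psi> R m"
      with that have "\<not> has_at_least R (approx_solutions \<psi> x (y m))"
        by (auto simp: approx_fibre_def approx_pairs_def)
      then show "W x (y m) \<le> R"
        unfolding W_def using c by (intro tent_sum_le_if_not_has_at_least) auto
    qed
    then show ?thesis by linarith
  qed
  have fibre_up: "measure lebesgue (approx_fibre y \<psi> R m) \<le> 1" for m
  proof -
    have "measure lebesgue (approx_fibre y \<psi> R m) \<le> measure lebesgue {0..<1::real}"
      by (intro measure_mono_fmeasurable bounded_set_imp_lmeasurable)
        (auto simp: approx_fibre_borel, auto simp: approx_fibre_def)
    then show ?thesis by simp
  qed
  show "\<exists>M0. \<forall>M\<ge>M0. norm ((1 / real M) * (\<Sum>m = 1..M. measure lebesgue (approx_fibre y \<psi> R m)) - 1) < e"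
  proof (intro exI allI impI)
    \<comment> \<open>Taking \<open>M \<ge> 1\<close> excludes the value \<open>0\<close> that
      division by zero gives at \<open>M = 0\<close>.\<close>
    fix M assume M: "M \<ge> max M0 1"
    define D where "D = (\<Sum>m = 1..M. measure lebesgue (approx_fibre y \<psi> R m))"
    have "D \<le> (\<Sum>m = 1..M. 1)" unfolding D_def using fibre_up by (intro sum_mono) auto
    then have up: "D \<le> real M" by simp
    have "(\<Sum>m = 1..M. 1 - v (y m) / (S - R)\<^sup>2) \<le> D"
      unfolding D_def using fibre_low by (intro sum_mono) auto
    then have "real M - (\<Sum>m = 1..M. v (y m)) / (S - R)\<^sup>2 \<le> D"
      by (simp add: sum_subtractf sum_divide_distrib)
    moreover have "(\<Sum>m = 1..M. v (y m)) / (S - R)\<^sup>2 < e * real M"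
      using M0[of M] M SR by (simp add: field_simps)
    ultimately have "real M - D < e * real M" by linarith
    with up M show "norm ((1 / real M) * (\<Sum>m = 1..M. measure lebesgue (approx_fibre y \<psi> R m)) - 1) < e"
      unfolding D_def[symmetric] by (auto simp: abs_less_iff field_simps intro: order_le_less_trans[of _ 0])
  qed
qed

end
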